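(* Let $\mathcal H$ be a real Hilbert space and let $C_1,C_2,\dots,C_N\subseteq\mathcal H$ be closed and convex sets with nonempty intersection $\bigcap_{i=1}^N C_i\neq\emptyset$. Let $T_{[C_1\,C_2\,\dots\,C_N]}:\mathcal H\to\mathcal H$ be the cyclic Douglas--Rachford operator. For any $x_0\in\mathcal H$, the sequence $\left(T_{[C_1\,C_2\,\dots\,C_N]}^n x_0\right)_{n}$ converges weakly to a point $x\in\mathcal H$ such that $P_{C_i}x=P_{C_j}x$ for all indices $i,j\in\{1,\dots,N\}$. Moreover, $P_{C_j}x\in\bigcap_{i=1}^N C_i$ for each index $j\in\{1,\dots,N\}$.
   Context: For a nonempty closed convex set $C\subseteq\mathcal H$, $P_C:\mathcal H\to C$ denotes the nearest point projection onto $C$, and $R_C:=2P_C-I$ is the reflection about $C$, where $I$ is the identity operator. For nonempty closed convex $A,B\subseteq\mathcal H$, the $2$-set Douglas--Rachford operator is $T_{A,B}:=\frac{1}{2}(I+R_BR_A)$, where products of operators denote composition. The cyclic Douglas--Rachford operator is $$T_{[C_1\,C_2\,\dots\,C_N]}:=T_{C_N,C_1}\,T_{C_{N-1},C_N}\cdots T_{C_2,C_3}\,T_{C_1,C_2},$$ that is, $T_{C_1,C_2}$ is applied first and $T_{C_N,C_1}$ last. *)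

theory Defs
  imports "HOL-Analysis.Analysis"
begin

text \<open>
  The defining formula is that of \<^const>\<open>closest_point\<close>, whose type demands \<open>heine_borel\<close> and
  thereby excludes infinite-dimensional spaces.
\<close>

definition proj :: "'a::real_inner set \<Rightarrow> 'a \<Rightarrow> 'a"
  where "proj C x = (SOME p. p \<in> C \<and> (\<forall>y\<in>C. dist x p \<le> dist x y))"

definition reflection :: "'a::real_inner set \<Rightarrow> 'a \<Rightarrow> 'a"
  where "reflection C x = 2 *\<^sub>R proj C x - x"

definition DR :: "'a::real_inner set \<Rightarrow> 'a set \<Rightarrow> 'a \<Rightarrow> 'a"
  where "DR A B x = (1/2) *\<^sub>R (x + reflection B (reflection A x))"

text \<open>
  The family is indexed by \<open>1, \<dots>, N\<close>. The fold applies \<open>DR (C 1) (C 2)\<close> first and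
  \<open>DR (C (N - 1)) (C N)\<close> last. For \<open>N = 1\<close> the operator is \<open>DR (C 1) (C 1)\<close>.
\<close>

definition cyclic_DR :: "nat \<Rightarrow> (nat \<Rightarrow> 'a::real_inner set) \<Rightarrow> 'a \<Rightarrow> 'a"
  where "cyclic_DR N C = DR (C N) (C 1) \<circ> fold (\<lambda>i. DR (C i) (C (Suc i))) [1..<N]"

definition weakly_converges_to :: "(nat \<Rightarrow> 'a::real_normed_vector) \<Rightarrow> 'a \<Rightarrow> bool"
  where "weakly_converges_to X x \<longleftrightarrow>
    (\<forall>f :: 'a \<Rightarrow> real. bounded_linear f \<longrightarrow> (\<lambda>n. f (X n)) \<longlonglongrightarrow> f x)"

end

theory Submission
  imports Defs
begin

text \<open>
  Each factor of the cyclic operator is firmly nonexpansive and fixes every point of the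
  intersection, so the iterates are Fejer monotone and are asymptotically fixed by every factor.
  Weak limits come from asymptotic centres instead of weak compactness: the asymptotic centre
  along a filter is fixed by every factor, by Fejer monotonicity it is the same for all finer
  filters, and in a Hilbert space this forces weak convergence to it. If \<open>x\<close> is fixed by every
  factor, then the projection of \<open>x\<close> onto a set lies in the next one; so the distances from \<open>x\<close>
  to the sets decrease cyclically, hence agree, and the projections coincide by uniqueness.
\<close>

section \<open>Minimisers and projections\<close>

text \<open>The parallelogram law as Apollonius' median formula. The term
  \<open>(dist a b)\<^sup>2 / 4\<close> is the strong convexity behind both projections and
  asymptotic centres.\<close>

lemma norm_midpoint_diff_sq:
  fixes a b u :: "'a::real_inner"
  shows "(norm (u - midpoint a b))\<^sup>2 = ((norm (u - a))\<^sup>2 + (norm (u - b))\<^sup>2) / 2 - (dist a b)\<^sup>2 / 4"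
proof -
  have "midpoint a b = (1/2) *\<^sub>R a + (1/2) *\<^sub>R b"
    by (simp add: midpoint_def scaleR_add_right)
  then show ?thesis
    unfolding dist_norm power2_norm_eq_inner
    by (simp add: inner_add_left inner_add_right inner_diff_left inner_diff_right inner_commute field_simps)
qed

text \<open>A minimising sequence is Cauchy, so completeness does the work of compactness. It serves
  for squared distances and for squared asymptotic radii.\<close>

lemma strongly_midpoint_convex_attains_min:
  fixes g :: "'a::{real_inner,complete_space} \<Rightarrow> real"
  assumes "closed C" "convex C" "C \<noteq> {}" and cont: "continuous_on C g" and bdd: "bdd_below (g ` C)"
    and mid: "\<And>a b. a \<in> C \<Longrightarrow> b \<in> C \<Longrightarrow> g (midpoint a b) \<le> (g a + g b) / 2 - (dist a b)\<^sup>2 / 4"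
  shows "\<exists>p\<in>C. \<forall>y\<in>C. g p \<le> g y"
proof -
  define m where "m = Inf (g ` C)"
  have m_le: "m \<le> g y" if "y \<in> C" for y
    unfolding m_def using bdd that by (intro cInf_lower) auto
  have "\<exists>y\<in>C. g y < m + 1 / real (Suc k)" for k
    using cInf_lessD[of "g ` C" "m + 1 / real (Suc k)"] \<open>C \<noteq> {}\<close> unfolding m_def by auto
  then obtain y where y: "\<And>k. y k \<in> C" "\<And>k. g (y k) < m + 1 / real (Suc k)"
    by metis
  \<comment> \<open>The value at the midpoint is at least \<open>m\<close>, so a quarter of the
    squared gap is at most the mean of the two excesses over \<open>m\<close>.\<close>
  have est: "(dist (y j) (y k))\<^sup>2 \<le> 2 * (1 / real (Suc j)) + 2 * (1 / real (Suc k))" for j k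
  proof -
    have "midpoint (y j) (y k) \<in> C"
      using convexD[OF \<open>convex C\<close> y(1)[of j] y(1)[of k], of "1/2" "1/2"]
      by (simp add: midpoint_def scaleR_add_right)
    then have "m \<le> (g (y j) + g (y k)) / 2 - (dist (y j) (y k))\<^sup>2 / 4"
      using m_le mid[OF y(1)[of j] y(1)[of k]] by force
    moreover have "d \<le> 2 * a + 2 * b"
      if "m \<le> (s + t) / 2 - d / 4" "s < m + a" "t < m + b" for a b s t d :: real
      using that by (simp add: field_simps)
    ultimately show ?thesis using y(2) by blast
  qed
  have "Cauchy y"
  proof (rule metric_CauchyI)
    fix e :: real assume "e > 0"
    then obtain K where K: "1 / real (Suc K) < e\<^sup>2 / 4"
      using nat_approx_posE[of "e\<^sup>2 / 4"] by auto
    have "dist (y j) (y k) < e" if "j \<ge> K" "k \<ge> K" for j k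
    proof -
      have "1 / real (Suc j) \<le> 1 / real (Suc K)" "1 / real (Suc k) \<le> 1 / real (Suc K)"
        using that by (auto simp: frac_le)
      then have "(dist (y j) (y k))\<^sup>2 < e\<^sup>2" using est[of j k] K by linarith
      then show ?thesis using \<open>e > 0\<close> by (simp add: power2_less_imp_less)
    qed
    then show "\<exists>M. \<forall>m\<ge>M. \<forall>n\<ge>M. dist (y m) (y n) < e" by blast
  qed
  then obtain p where p: "y \<longlonglongrightarrow> p" using Cauchy_convergent convergent_def by blast
  have "p \<in> C" using closed_sequentially[OF \<open>closed C\<close>] y(1) p by blast
  have "(\<lambda>k. g (y k)) \<longlonglongrightarrow> g p"
    using continuous_on_tendsto_compose[OF cont p \<open>p \<in> C\<close>] y(1) by auto
  moreover have "(\<lambda>k. m + 1 / real (Suc k)) \<longlonglongrightarrow> m + 0"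
    using LIMSEQ_inverse_real_of_nat by (intro tendsto_intros) (simp add: inverse_eq_divide)
  ultimately have "g p \<le> m"
    using LIMSEQ_le y(2) by (metis (no_types, lifting) add.right_neutral less_imp_le)
  then show ?thesis using m_le \<open>p \<in> C\<close> by (meson order_trans)
qed

lemma nearest_point_exists:
  fixes C :: "'a::{real_inner,complete_space} set"
  assumes "closed C" "convex C" "C \<noteq> {}"
  shows "\<exists>p\<in>C. \<forall>y\<in>C. dist x p \<le> dist x y"
proof -
  have "\<exists>p\<in>C. \<forall>y\<in>C. (dist x p)\<^sup>2 \<le> (dist x y)\<^sup>2"
  proof (rule strongly_midpoint_convex_attains_min[OF assms])
    show "continuous_on C (\<lambda>y. (dist x y)\<^sup>2)" by (intro continuous_intros)
    show "bdd_below ((\<lambda>y. (dist x y)\<^sup>2) ` C)" by (rule bdd_belowI[of _ 0]) auto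
  qed (simp add: norm_midpoint_diff_sq dist_norm[of x])
  then show ?thesis by (meson power2_le_imp_le zero_le_dist)
qed

lemma
  fixes C :: "'a::{real_inner,complete_space} set"
  assumes C: "closed C" "convex C" "C \<noteq> {}"
  shows proj_in: "proj C x \<in> C"
    and proj_le: "y \<in> C \<Longrightarrow> dist x (proj C x) \<le> dist x y"
proof -
  have "\<exists>p. p \<in> C \<and> (\<forall>y\<in>C. dist x p \<le> dist x y)"
    using nearest_point_exists[OF C] by blast
  from someI_ex[OF this] show "proj C x \<in> C" "y \<in> C \<Longrightarrow> dist x (proj C x) \<le> dist x y"
    unfolding proj_def by auto
qed

text \<open>Variational inequality: moving from the nearest point towards \<open>y\<close> stays in
  \<open>C\<close> and cannot bring one closer to \<open>x\<close>.\<close>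

lemma proj_dot:
  fixes C :: "'a::{real_inner,complete_space} set"
  assumes "closed C" "convex C" "y \<in> C"
  shows "inner (x - proj C x) (y - proj C x) \<le> 0"
  using assms proj_in[of C x] proj_le[of C _ x] by (intro any_closest_point_dot[of C]) auto

lemma proj_eqI:
  fixes C :: "'a::{real_inner,complete_space} set"
  assumes C: "closed C" "convex C" and p: "p \<in> C" "\<And>y. y \<in> C \<Longrightarrow> dist x p \<le> dist x y"
  shows "proj C x = p"
  using C p proj_in[of C x] proj_le[of C _ x] by (intro any_closest_point_unique[of C _ _ x]) auto

text \<open>The point of the hyperplane \<open>f = 1\<close> nearest to the origin is orthogonal to
  the kernel of \<open>f\<close>; divided by its squared norm it represents \<open>f\<close>. This
  turns weak convergence into a statement on inner products.\<close>

lemma riesz_representation: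
  fixes f :: "'a::{real_inner,complete_space} \<Rightarrow> real"
  assumes f: "bounded_linear f"
  shows "\<exists>v. \<forall>x. f x = inner x v"
proof (cases "\<forall>x. f x = 0")
  case True
  then show ?thesis by (metis inner_zero_right)
next
  case False
  interpret f: bounded_linear f by (fact f)
  from False obtain w where w: "f w \<noteq> 0" by blast
  define S where "S = {x. f x = 1}"
  have "closed S"
    unfolding S_def by (intro closed_Collect_eq continuous_intros f.continuous_on)
  moreover have "convex S"
    unfolding S_def by (rule convexI) (simp add: f.add f.scaleR)
  moreover have "(1 / f w) *\<^sub>R w \<in> S" using w by (simp add: S_def f.scaleR)
  ultimately have S: "closed S" "convex S" "S \<noteq> {}" by auto
  define p where "p = proj S 0"
  have fp: "f p = 1" using proj_in[OF S, of 0] by (simp add: S_def p_def)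
  then have "p \<noteq> 0" using f.zero by force
  have ker: "inner p x = 0" if "f x = 0" for x
  proof -
    \<comment> \<open>Both signs of \<open>x\<close> are admissible, so the variational inequality
      becomes an equality.\<close>
    have "p + x \<in> S" "p - x \<in> S" using that fp by (simp_all add: S_def f.add f.diff)
    then show ?thesis
      using proj_dot[OF S(1,2), of "p + x" 0] proj_dot[OF S(1,2), of "p - x" 0]
      unfolding p_def[symmetric] by simp
  qed
  have "f x = inner x ((1 / (norm p)\<^sup>2) *\<^sub>R p)" for x
  proof -
    have "inner p (x - f x *\<^sub>R p) = 0" by (rule ker) (simp add: f.diff f.scaleR fp)
    then show ?thesis
      using \<open>p \<noteq> 0\<close> by (simp add: inner_diff_right inner_commute power2_norm_eq_inner)
  qed
  then show ?thesis by blast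
qed

section \<open>Asymptotic centres and weak convergence\<close>

text \<open>For nontrivial \<open>F\<close> and bounded \<open>u\<close> this is the limit superior
  of \<open>dist (u n) y\<close> along \<open>F\<close>. General filters allow restriction to a set
  of indices, in place of subsequences.\<close>

definition asymptotic_radius :: "'b filter \<Rightarrow> ('b \<Rightarrow> 'a::metric_space) \<Rightarrow> 'a \<Rightarrow> real"
  where "asymptotic_radius F u y = Inf {c. \<forall>\<^sub>F n in F. dist (u n) y \<le> c}"

locale bounded_net =
  fixes F :: "'b filter" and u :: "'b \<Rightarrow> 'a::{real_inner,complete_space}"
  assumes nontriv: "F \<noteq> bot" and bounded: "bounded (range u)"
begin

abbreviation "rad \<equiv> asymptotic_radius F u"

lemma radius_nonneg_aux: "\<forall>\<^sub>F n in F. dist (u n) y \<le> c \<Longrightarrow> 0 \<le> c"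
  using eventually_happens'[OF nontriv] by (meson order_trans zero_le_dist)

lemma radius_le: "\<forall>\<^sub>F n in F. dist (u n) y \<le> c \<Longrightarrow> rad y \<le> c"
  unfolding asymptotic_radius_def
  by (rule cInf_lower) (auto intro!: bdd_belowI[of _ 0] radius_nonneg_aux)

lemma radius_set_nonempty: "{c. \<forall>\<^sub>F n in F. dist (u n) y \<le> c} \<noteq> {}"
proof -
  obtain c where "\<And>n. dist y (u n) \<le> c"
    using bounded by (metis bounded_any_center rangeI)
  then have "\<forall>\<^sub>F n in F. dist (u n) y \<le> c" by (simp add: dist_commute)
  then show ?thesis by blast
qed

lemma radius_nonneg: "0 \<le> rad y"
  unfolding asymptotic_radius_def
  by (rule cInf_greatest[OF radius_set_nonempty]) (auto intro: radius_nonneg_aux)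

lemma eventually_radius: "rad y < c \<Longrightarrow> \<forall>\<^sub>F n in F. dist (u n) y \<le> c"
  unfolding asymptotic_radius_def
  using cInf_lessD[OF radius_set_nonempty] by (fastforce elim: eventually_mono)

text \<open>Used to compare radii along a filter and a finer one: where the distances converge, both
  equal the limit.\<close>

lemma radius_lim:
  assumes "((\<lambda>n. dist (u n) y) \<longlongrightarrow> l) F"
  shows "rad y = l"
proof (rule antisym)
  show "rad y \<le> l"
  proof (rule dense_ge)
    fix c assume "l < c"
    with assms have "\<forall>\<^sub>F n in F. dist (u n) y < c" by (simp add: order_tendstoD)
    then show "rad y \<le> c" by (intro radius_le) (auto elim: eventually_mono)
  qed
  show "l \<le> rad y"
    by (rule dense_ge) (rule tendsto_upperbound[OF assms eventually_radius nontriv])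
qed

text \<open>An error tending to \<open>e\<close> adds at most \<open>e\<close> to a limit superior.
  A constant error gives Lipschitz continuity of the radius, a vanishing one the invariance of the
  centre.\<close>

lemma radius_le_asymp_shift:
  assumes d: "((\<lambda>n. d n) \<longlongrightarrow> e) F" and le: "\<And>n. dist (u n) z \<le> dist (u n) y + d n"
  shows "rad z \<le> rad y + e"
proof (rule field_le_epsilon)
  fix \<epsilon> :: real assume "\<epsilon> > 0"
  then have "\<forall>\<^sub>F n in F. dist (u n) y \<le> rad y + \<epsilon>/2" "\<forall>\<^sub>F n in F. d n < e + \<epsilon>/2"
    using d by (auto intro: eventually_radius order_tendstoD(2))
  then have "\<forall>\<^sub>F n in F. dist (u n) z \<le> rad y + e + \<epsilon>"
  proof eventually_elim
    case (elim n)
    then show ?case using le[of n] by argo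
  qed
  then show "rad z \<le> rad y + e + \<epsilon>" by (rule radius_le)
qed

lemma continuous_on_radius: "continuous_on UNIV rad"
proof -
  have le: "rad z \<le> rad y + dist y z" for y z
    by (rule radius_le_asymp_shift[OF tendsto_const]) (rule dist_triangle)
  have "dist (rad y) (rad z) \<le> dist y z" for y z
    using le[of y z] le[of z y] by (auto simp: dist_real_def dist_commute abs_le_iff)
  then show ?thesis
    by (intro lipschitz_on_continuous_on[of 1] lipschitz_onI) auto
qed

lemma radius_sq_leI:
  assumes "\<And>c. rad y < c \<Longrightarrow> \<forall>\<^sub>F n in F. (dist (u n) z)\<^sup>2 \<le> c\<^sup>2 - k"
  shows "(rad z)\<^sup>2 \<le> (rad y)\<^sup>2 - k"
proof (rule field_le_epsilon)
  fix \<epsilon> :: real assume "\<epsilon> > 0"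
  \<comment> \<open>Chosen so that its square exceeds \<open>(rad y)\<^sup>2\<close> by exactly
    \<epsilon>.\<close>
  define c where "c = sqrt ((rad y)\<^sup>2 + \<epsilon>)"
  have "rad y < c" unfolding c_def using \<open>\<epsilon> > 0\<close> by (intro real_less_rsqrt) auto
  have c2: "c\<^sup>2 = (rad y)\<^sup>2 + \<epsilon>" unfolding c_def using \<open>\<epsilon> > 0\<close> by simp
  have "\<forall>\<^sub>F n in F. dist (u n) z \<le> sqrt (c\<^sup>2 - k)"
    using assms[OF \<open>rad y < c\<close>] by eventually_elim (rule real_le_rsqrt)
  \<comment> \<open>\<open>sqrt\<close> is negative at negative arguments, so the second fact yields
    \<open>0 \<le> c\<^sup>2 - k\<close>, which squaring requires.\<close>
  then have "rad z \<le> sqrt (c\<^sup>2 - k)" "0 \<le> sqrt (c\<^sup>2 - k)"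
    by (rule radius_le, rule radius_nonneg_aux)
  then have "(rad z)\<^sup>2 \<le> c\<^sup>2 - k"
    using radius_nonneg[of z] by (metis real_sqrt_ge_0_iff real_sqrt_pow2 power_mono)
  then show "(rad z)\<^sup>2 \<le> (rad y)\<^sup>2 - k + \<epsilon>" using c2 by simp
qed

text \<open>The median formula at each \<open>u n\<close> passes to the limit superior, since its
  last term does not depend on \<open>n\<close>.\<close>

lemma radius_midpoint:
  "(rad (midpoint a b))\<^sup>2 \<le> ((rad a)\<^sup>2 + (rad b)\<^sup>2) / 2 - (dist a b)\<^sup>2 / 4"
proof (rule field_le_epsilon)
  fix \<epsilon> :: real assume "\<epsilon> > 0"
  define c where "c y = sqrt ((rad y)\<^sup>2 + \<epsilon>)" for y
  have c: "rad y < c y" for y unfolding c_def using \<open>\<epsilon> > 0\<close> by (intro real_less_rsqrt) auto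
  have c2: "(c y)\<^sup>2 = (rad y)\<^sup>2 + \<epsilon>" for y unfolding c_def using \<open>\<epsilon> > 0\<close> by simp
  define k where "k = ((rad a)\<^sup>2 + (rad b)\<^sup>2) / 2 - (dist a b)\<^sup>2 / 4 + \<epsilon>"
  have "\<forall>\<^sub>F n in F. dist (u n) (midpoint a b) \<le> sqrt k"
    using eventually_radius[OF c[of a]] eventually_radius[OF c[of b]]
  proof eventually_elim
    case (elim n)
    then have "(dist (u n) a)\<^sup>2 \<le> (c a)\<^sup>2" "(dist (u n) b)\<^sup>2 \<le> (c b)\<^sup>2"
      by (auto intro: power_mono)
    then have "(dist (u n) (midpoint a b))\<^sup>2 \<le> k"
      unfolding c2 k_def dist_norm[of "u n"] norm_midpoint_diff_sq by argo
    then show ?case by (rule real_le_rsqrt)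
  qed
  then have "rad (midpoint a b) \<le> sqrt k" "0 \<le> sqrt k"
    by (rule radius_le, rule radius_nonneg_aux)
  then show "(rad (midpoint a b))\<^sup>2 \<le> ((rad a)\<^sup>2 + (rad b)\<^sup>2) / 2 - (dist a b)\<^sup>2 / 4 + \<epsilon>"
    using radius_nonneg[of "midpoint a b"] unfolding k_def[symmetric]
    by (metis real_sqrt_ge_0_iff real_sqrt_pow2 power_mono)
qed

lemma asymptotic_center_exists: "\<exists>z. \<forall>y. rad z \<le> rad y"
proof -
  have "\<exists>z\<in>UNIV. \<forall>y\<in>UNIV. (rad z)\<^sup>2 \<le> (rad y)\<^sup>2"
  proof (rule strongly_midpoint_convex_attains_min)
    show "continuous_on UNIV (\<lambda>y. (rad y)\<^sup>2)" by (intro continuous_intros continuous_on_radius)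
    show "bdd_below ((\<lambda>y. (rad y)\<^sup>2) ` UNIV)" by (rule bdd_belowI[of _ 0]) auto
  qed (auto intro: radius_midpoint)
  then show ?thesis using radius_nonneg by (meson power2_le_imp_le iso_tuple_UNIV_I)
qed

text \<open>The midpoint of two distinct minimisers would have a strictly smaller radius.\<close>

lemma asymptotic_center_unique:
  assumes "\<And>y. rad z \<le> rad y" "rad w \<le> rad z"
  shows "w = z"
proof -
  have "(rad z)\<^sup>2 \<le> (rad (midpoint w z))\<^sup>2" "(rad w)\<^sup>2 \<le> (rad z)\<^sup>2"
    using assms radius_nonneg by (auto intro: power_mono)
  then have "(dist w z)\<^sup>2 \<le> 0" using radius_midpoint[of w z] by argo
  then show ?thesis by simp
qed

text \<open>Since \<open>T\<close> almost fixes \<open>u n\<close> and is nonexpansive,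
  \<open>T z\<close> is asymptotically no farther from the net than \<open>z\<close>; uniqueness of
  the centre concludes.\<close>

lemma asymptotic_center_fixed:
  assumes z: "\<And>y. rad z \<le> rad y"
    and T: "\<And>x y. dist (T x) (T y) \<le> dist x y"
    and reg: "((\<lambda>n. dist (T (u n)) (u n)) \<longlongrightarrow> 0) F"
  shows "T z = z"
proof (rule asymptotic_center_unique[OF z])
  have "dist (u n) (T z) \<le> dist (u n) z + dist (T (u n)) (u n)" for n
    using dist_triangle[of "u n" "T z" "T (u n)"] T[of "u n" z] by (simp add: dist_commute)
  from radius_le_asymp_shift[OF reg this] show "rad (T z) \<le> rad z" by simp
qed

end

text \<open>Were \<epsilon> positive, moving \<open>z\<close> a little along \<open>v\<close> would
  shorten all late distances by a definite amount, against minimality.\<close>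

lemma radius_minimal_imp_not_separated:
  fixes u :: "'b \<Rightarrow> 'a::{real_inner,complete_space}"
  assumes "bounded_net F u"
    and z: "\<And>y. asymptotic_radius F u z \<le> asymptotic_radius F u y"
    and sep: "\<forall>\<^sub>F n in F. inner (u n - z) v \<ge> \<epsilon>"
  shows "\<epsilon> \<le> 0"
proof (rule ccontr)
  interpret bounded_net F u by fact
  assume "\<not> \<epsilon> \<le> 0"
  then have "\<epsilon> > 0" by simp
  have "v \<noteq> 0"
    using eventually_happens'[OF nontriv sep] \<open>\<epsilon> > 0\<close> by auto
  \<comment> \<open>This \<open>t\<close> minimises
    \<open>t\<^sup>2 * (norm v)\<^sup>2 - 2 * t * \<epsilon>\<close>, with minimum
    \<open>- t * \<epsilon>\<close>.\<close>
  define t where "t = \<epsilon> / (norm v)\<^sup>2"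
  have t: "t > 0" "t * (norm v)\<^sup>2 = \<epsilon>" using \<open>\<epsilon> > 0\<close> \<open>v \<noteq> 0\<close> by (auto simp: t_def)
  have "(rad (z + t *\<^sub>R v))\<^sup>2 \<le> (rad z)\<^sup>2 - t * \<epsilon>"
  proof (rule radius_sq_leI)
    fix c assume "rad z < c"
    show "\<forall>\<^sub>F n in F. (dist (u n) (z + t *\<^sub>R v))\<^sup>2 \<le> c\<^sup>2 - t * \<epsilon>"
      using eventually_radius[OF \<open>rad z < c\<close>] sep
    proof eventually_elim
      case (elim n)
      have "(dist (u n) (z + t *\<^sub>R v))\<^sup>2 = (norm ((u n - z) - t *\<^sub>R v))\<^sup>2"
        by (simp add: dist_norm algebra_simps)
      also have "\<dots> = (dist (u n) z)\<^sup>2 - 2 * (t * inner (u n - z) v) + t * (t * (norm v)\<^sup>2)"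
        unfolding dist_norm power2_norm_eq_inner
        by (simp add: inner_diff_left inner_diff_right inner_commute algebra_simps)
      also have "\<dots> \<le> c\<^sup>2 - 2 * (t * \<epsilon>) + t * \<epsilon>"
        unfolding t(2) using elim t(1)
        by (intro add_mono diff_mono power_mono mult_left_mono order_refl) auto
      finally show ?case by (simp add: mult.commute)
    qed
  qed
  moreover have "(rad z)\<^sup>2 \<le> (rad (z + t *\<^sub>R v))\<^sup>2"
    using z radius_nonneg by (intro power_mono) auto
  ultimately show False using \<open>t > 0\<close> \<open>\<epsilon> > 0\<close> by (smt (verit) mult_pos_pos)
qed

text \<open>An Opial-type principle. If \<open>X\<close> kept returning to a half space away from
  its centre \<open>z\<close>, then \<open>z\<close> would still be the centre along those indices,
  which the preceding lemma forbids.\<close>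

lemma weakly_converges_to_common_fixed_point:
  fixes X :: "nat \<Rightarrow> 'a::{real_inner,complete_space}"
  assumes bdd: "bounded (range X)"
    and nonexp: "\<And>T x y. T \<in> \<T> \<Longrightarrow> dist (T x) (T y) \<le> dist x y"
    and reg: "\<And>T. T \<in> \<T> \<Longrightarrow> (\<lambda>n. dist (T (X n)) (X n)) \<longlonglongrightarrow> 0"
    and fejer: "\<And>p. (\<And>T. T \<in> \<T> \<Longrightarrow> T p = p) \<Longrightarrow> convergent (\<lambda>n. dist (X n) p)"
  shows "\<exists>z. weakly_converges_to X z \<and> (\<forall>T\<in>\<T>. T z = z)"
proof -
  interpret S: bounded_net sequentially X by unfold_locales (auto simp: bdd)
  obtain z where z: "\<And>y. S.rad z \<le> S.rad y" using S.asymptotic_center_exists by blast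
  have fix_z: "T z = z" if "T \<in> \<T>" for T
    by (rule S.asymptotic_center_fixed[OF z nonexp[OF that] reg[OF that]])
  have ev: "\<forall>\<^sub>F n in sequentially. inner (X n - z) v < \<epsilon>" if "\<epsilon> > 0" for v \<epsilon>
  proof (rule ccontr)
    assume sep: "\<not> (\<forall>\<^sub>F n in sequentially. inner (X n - z) v < \<epsilon>)"
    \<comment> \<open>The indices violating the bound act as a subsequence; \<open>sep\<close> says
      that this filter is nontrivial.\<close>
    define G where "G = inf sequentially (principal {n. \<epsilon> \<le> inner (X n - z) v})"
    have "G \<noteq> bot"
      using sep unfolding G_def trivial_limit_def eventually_inf_principal
      by (auto simp: not_le elim!: eventually_mono)
    then interpret G: bounded_net G X by unfold_locales (auto simp: bdd)
    have le: "G \<le> sequentially" by (simp add: G_def)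
    \<comment> \<open>Here the convergence of distances enters: at a common fixed point both radii
      are the same limit.\<close>
    have rad_eq: "G.rad p = S.rad p" if p: "\<And>T. T \<in> \<T> \<Longrightarrow> T p = p" for p
    proof -
      obtain l where "(\<lambda>n. dist (X n) p) \<longlonglongrightarrow> l"
        using fejer[of p] p by (auto simp: convergent_def)
      then show ?thesis using S.radius_lim G.radius_lim tendsto_mono[OF le] by metis
    qed
    obtain w where w: "\<And>y. G.rad w \<le> G.rad y" using G.asymptotic_center_exists by blast
    have "T w = w" if "T \<in> \<T>" for T
      by (rule G.asymptotic_center_fixed[OF w nonexp[OF that] tendsto_mono[OF le reg[OF that]]])
    \<comment> \<open>Both centres are common fixed points, where the radii agree, so minimality of
      \<open>z\<close> carries over to \<open>G\<close>.\<close>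
    then have "G.rad z \<le> G.rad w" using z rad_eq fix_z by simp
    then have "G.rad z \<le> G.rad y" for y using w order_trans by blast
    moreover have "\<forall>\<^sub>F n in G. inner (X n - z) v \<ge> \<epsilon>"
      by (simp add: G_def eventually_inf_principal)
    ultimately have "\<epsilon> \<le> 0"
      using radius_minimal_imp_not_separated G.bounded_net_axioms by blast
    with \<open>\<epsilon> > 0\<close> show False by simp
  qed
  have "(\<lambda>n. f (X n)) \<longlonglongrightarrow> f z" if f: "bounded_linear f" for f :: "'a \<Rightarrow> real"
  proof -
    obtain v where v: "\<And>x. f x = inner x v" using riesz_representation[OF f] by blast
    show ?thesis
    proof (rule tendstoI)
      fix \<epsilon> :: real assume "\<epsilon> > 0"
      from ev[OF this, of v] ev[OF this, of "- v"]
      show "\<forall>\<^sub>F n in sequentially. dist (f (X n)) (f z) < \<epsilon>"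
        by eventually_elim (auto simp: v dist_real_def inner_diff_left)
    qed
  qed
  then show ?thesis using fix_z unfolding weakly_converges_to_def by blast
qed

section \<open>Firmly nonexpansive maps\<close>

text \<open>Equivalent to \<open>T\<close> being the average of the identity and a nonexpansive map;
  this form keeps the displacement term visible.\<close>

definition firmly_nonexpansive :: "('a::real_inner \<Rightarrow> 'a) \<Rightarrow> bool"
  where "firmly_nonexpansive T \<longleftrightarrow>
    (\<forall>x y. (norm (T x - T y))\<^sup>2 + (norm ((x - T x) - (y - T y)))\<^sup>2 \<le> (norm (x - y))\<^sup>2)"

lemma firmly_nonexpansive_imp_nonexpansive:
  assumes "firmly_nonexpansive T"
  shows "dist (T x) (T y) \<le> dist x y"
proof -
  have "(norm (T x - T y))\<^sup>2 \<le> (norm (x - y))\<^sup>2"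
    using assms unfolding firmly_nonexpansive_def by (smt (verit) zero_le_power2)
  then show ?thesis unfolding dist_norm by (rule power2_le_imp_le) simp
qed

text \<open>At a fixed point the displacement term is the step length, so every step is paid for by
  a drop in squared distance to \<open>p\<close>.\<close>

lemma firmly_nonexpansive_fixed:
  assumes "firmly_nonexpansive T" "T p = p"
  shows "(dist (T x) x)\<^sup>2 \<le> (dist x p)\<^sup>2 - (dist (T x) p)\<^sup>2"
proof -
  have "(norm (T x - T p))\<^sup>2 + (norm ((x - T x) - (p - T p)))\<^sup>2 \<le> (norm (x - p))\<^sup>2"
    using assms(1) unfolding firmly_nonexpansive_def by blast
  then show ?thesis using assms(2) by (simp add: dist_norm norm_minus_commute)
qed

section \<open>Composition of a list of maps, head applied first\<close>

lemma fold_fixed: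
  assumes "\<And>T. T \<in> set Ts \<Longrightarrow> T p = p"
  shows "fold (\<lambda>T. T) Ts p = p"
  using assms
proof (induction Ts)
  case (Cons T Ts)
  have "T p = p" by (rule Cons.prems) simp
  moreover have "fold (\<lambda>T. T) Ts p = p" by (rule Cons.IH) (simp add: Cons.prems)
  ultimately show ?case by simp
qed simp

lemma fold_nonexpansive:
  assumes "\<And>T x y. T \<in> set Ts \<Longrightarrow> dist (T x) (T y) \<le> dist x y"
  shows "dist (fold (\<lambda>T. T) Ts x) (fold (\<lambda>T. T) Ts y) \<le> dist x y"
  using assms
proof (induction Ts arbitrary: x y)
  case (Cons T Ts)
  have "dist (fold (\<lambda>T. T) Ts (T x)) (fold (\<lambda>T. T) Ts (T y)) \<le> dist (T x) (T y)"
    using Cons by simp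
  then show ?case using Cons.prems[of T x y] by simp
qed simp

text \<open>The loss of squared distance over a sweep is the sum of the nonnegative losses of its
  factors, so each of these vanishes too. The sequence is arbitrary because the induction passes
  from \<open>Y n\<close> to \<open>U (Y n)\<close>.\<close>

lemma fold_asymptotically_fixed:
  fixes Y :: "nat \<Rightarrow> 'a::real_inner"
  assumes "\<And>T. T \<in> set Ts \<Longrightarrow> firmly_nonexpansive T" "\<And>T. T \<in> set Ts \<Longrightarrow> T p = p"
    and "(\<lambda>n. (dist (Y n) p)\<^sup>2 - (dist (fold (\<lambda>T. T) Ts (Y n)) p)\<^sup>2) \<longlonglongrightarrow> 0"
    and "T \<in> set Ts"
  shows "(\<lambda>n. dist (T (Y n)) (Y n)) \<longlonglongrightarrow> 0"
  using assms
proof (induction Ts arbitrary: Y)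
  case (Cons U Ts)
  let ?W = "fold (\<lambda>T. T) Ts"
  have U: "firmly_nonexpansive U" "U p = p" using Cons.prems by auto
  note lim = Cons.prems(3)[simplified]
  have "dist (?W (U x)) (?W p) \<le> dist (U x) p" for x
    using Cons.prems by (intro fold_nonexpansive firmly_nonexpansive_imp_nonexpansive) auto
  moreover have "?W p = p" using Cons.prems by (intro fold_fixed) auto
  ultimately have W: "(dist (?W (U x)) p)\<^sup>2 \<le> (dist (U x) p)\<^sup>2" for x
    by (simp add: power_mono)
  have le: "(dist (U x) x)\<^sup>2 \<le> (dist x p)\<^sup>2 - (dist (U x) p)\<^sup>2" for x
    by (rule firmly_nonexpansive_fixed[OF U])
  have le': "(dist (U x) p)\<^sup>2 \<le> (dist x p)\<^sup>2" for x
    using le[of x] by (smt (verit) zero_le_power2)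
  \<comment> \<open>The later factors cannot increase the distance to \<open>p\<close>, so the drop
    at \<open>U\<close> is at most the total drop.\<close>
  have "(\<lambda>n. (dist (U (Y n)) (Y n))\<^sup>2) \<longlonglongrightarrow> 0"
  proof (rule tendsto_sandwich[OF _ _ tendsto_const lim])
    show "\<forall>\<^sub>F n in sequentially. (dist (U (Y n)) (Y n))\<^sup>2
        \<le> (dist (Y n) p)\<^sup>2 - (dist (?W (U (Y n))) p)\<^sup>2"
      using le W by (intro always_eventually allI) (meson diff_left_mono order_trans)
  qed simp
  from tendsto_real_sqrt[OF this] have U0: "(\<lambda>n. dist (U (Y n)) (Y n)) \<longlonglongrightarrow> 0" by simp
  show ?case
  proof (cases "T = U")
    case True
    then show ?thesis using U0 by simp
  next
    case False
    then have T: "T \<in> set Ts" "firmly_nonexpansive T" using Cons.prems by auto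
    have "(\<lambda>n. (dist (U (Y n)) p)\<^sup>2 - (dist (?W (U (Y n))) p)\<^sup>2) \<longlonglongrightarrow> 0"
      using W le' by (intro tendsto_sandwich[OF _ _ tendsto_const lim] always_eventually allI)
        (simp_all add: diff_right_mono)
    then have T0: "(\<lambda>n. dist (T (U (Y n))) (U (Y n))) \<longlonglongrightarrow> 0"
      using Cons.IH[of "\<lambda>n. U (Y n)"] Cons.prems T by auto
    have sum0: "(\<lambda>n. dist (T (U (Y n))) (U (Y n)) + 2 * dist (U (Y n)) (Y n)) \<longlonglongrightarrow> 0"
      using tendsto_add[OF T0 tendsto_mult_left[OF U0, of 2]] by simp
    \<comment> \<open>The detour through \<open>T (U (Y n))\<close> and \<open>U (Y n)\<close> costs
      \<open>dist (U (Y n)) (Y n)\<close> twice: once by nonexpansiveness of \<open>T\<close>, once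
      directly.\<close>
    have "dist (T (Y n)) (Y n) \<le> dist (T (U (Y n))) (U (Y n)) + 2 * dist (U (Y n)) (Y n)" for n
      using dist_triangle[of "T (Y n)" "Y n" "T (U (Y n))"]
        dist_triangle[of "T (U (Y n))" "Y n" "U (Y n)"]
        firmly_nonexpansive_imp_nonexpansive[OF T(2), of "Y n" "U (Y n)"]
      by (simp add: dist_commute)
    then show ?thesis
      by (intro tendsto_sandwich[OF _ _ tendsto_const sum0] always_eventually allI) auto
  qed
qed simp

lemma weak_convergence_iterated_fold:
  fixes x0 :: "'a::{real_inner,complete_space}"
  assumes fne: "\<And>T. T \<in> set Ts \<Longrightarrow> firmly_nonexpansive T"
    and p: "\<And>T. T \<in> set Ts \<Longrightarrow> T p = p"
  shows "\<exists>z. weakly_converges_to (\<lambda>n. (fold (\<lambda>T. T) Ts ^^ n) x0) z \<and> (\<forall>T\<in>set Ts. T z = z)"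
proof (rule weakly_converges_to_common_fixed_point)
  let ?W = "fold (\<lambda>T. T) Ts"
  let ?X = "\<lambda>n. (?W ^^ n) x0"
  have nonexp: "dist (T x) (T y) \<le> dist x y" if "T \<in> set Ts" for T x y
    using firmly_nonexpansive_imp_nonexpansive[OF fne[OF that]] .
  then show "\<And>T x y. T \<in> set Ts \<Longrightarrow> dist (T x) (T y) \<le> dist x y" .
  have dec: "decseq (\<lambda>n. dist (?X n) q)" if "\<And>T. T \<in> set Ts \<Longrightarrow> T q = q" for q
  proof (rule decseq_SucI)
    fix n
    have "?W q = q" using that by (rule fold_fixed)
    moreover have "dist (?W (?X n)) (?W q) \<le> dist (?X n) q"
      using nonexp by (rule fold_nonexpansive)
    ultimately show "dist (?X (Suc n)) q \<le> dist (?X n) q" by simp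
  qed
  show conv: "convergent (\<lambda>n. dist (?X n) q)" if "\<And>T. T \<in> set Ts \<Longrightarrow> T q = q" for q
    using decseq_convergent[OF dec, of q 0] that by (metis convergent_def zero_le_dist)
  show "bounded (range ?X)"
  proof (rule boundedI[of _ "norm p + dist x0 p"], clarify)
    fix n
    have "dist (?X n) p \<le> dist x0 p" using decseqD[OF dec, of p 0 n] p by simp
    then show "norm (?X n) \<le> norm p + dist x0 p"
      using norm_triangle_sub[of "?X n" p] by (simp add: dist_norm)
  qed
  obtain l where l: "(\<lambda>n. dist (?X n) p) \<longlonglongrightarrow> l" using conv[of p] p by (auto simp: convergent_def)
  \<comment> \<open>Consecutive squared distances share a limit, so the loss per sweep
    vanishes.\<close>
  have "(\<lambda>n. (dist (?X n) p)\<^sup>2 - (dist (?X (Suc n)) p)\<^sup>2) \<longlonglongrightarrow> l\<^sup>2 - l\<^sup>2"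
    by (intro tendsto_intros l LIMSEQ_Suc[OF l])
  then show "(\<lambda>n. dist (T (?X n)) (?X n)) \<longlonglongrightarrow> 0" if "T \<in> set Ts" for T
    using fold_asymptotically_fixed[of Ts p ?X T] fne p that by simp
qed

section \<open>Douglas--Rachford operators\<close>

text \<open>Expanding the square leaves four times the sum of two variational inequalities, one at
  each projection.\<close>

lemma reflection_nonexpansive:
  fixes C :: "'a::{real_inner,complete_space} set"
  assumes C: "closed C" "convex C" "C \<noteq> {}"
  shows "norm (reflection C x - reflection C y) \<le> norm (x - y)"
proof (rule power2_le_imp_le)
  let ?p = "proj C x" and ?q = "proj C y"
  have "inner (x - ?p) (?q - ?p) \<le> 0" "inner (y - ?q) (?p - ?q) \<le> 0"
    using proj_dot proj_in C by blast+
  moreover have "(norm (reflection C x - reflection C y))\<^sup>2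
      = (norm (x - y))\<^sup>2 + 4 * (inner (x - ?p) (?q - ?p) + inner (y - ?q) (?p - ?q))"
    unfolding reflection_def power2_norm_eq_inner
    by (simp add: inner_diff_left inner_diff_right inner_commute algebra_simps)
  ultimately show "(norm (reflection C x - reflection C y))\<^sup>2 \<le> (norm (x - y))\<^sup>2" by auto
qed simp

text \<open>\<open>DR A B\<close> averages the identity with a nonexpansive composition of
  reflections; the parallelogram law for \<open>x - y\<close> and \<open>s\<close> gives the
  two-term inequality.\<close>

lemma DR_firmly_nonexpansive:
  fixes A B :: "'a::{real_inner,complete_space} set"
  assumes A: "closed A" "convex A" "A \<noteq> {}" and B: "closed B" "convex B" "B \<noteq> {}"
  shows "firmly_nonexpansive (DR A B)"
  unfolding firmly_nonexpansive_def
proof (intro allI)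
  fix x y
  define s where "s = reflection B (reflection A x) - reflection B (reflection A y)"
  have "norm s \<le> norm (x - y)"
    unfolding s_def using reflection_nonexpansive[OF A] reflection_nonexpansive[OF B] order_trans
    by blast
  then have s: "(norm s)\<^sup>2 \<le> (norm (x - y))\<^sup>2" by (simp add: power_mono)
  have T: "DR A B x - DR A B y = (1/2) *\<^sub>R ((x - y) + s)"
    by (simp add: DR_def s_def algebra_simps)
  have "(x - DR A B x) - (y - DR A B y) = (x - y) - (DR A B x - DR A B y)" by simp
  also have "\<dots> = (1/2) *\<^sub>R ((x - y) - s)"
    unfolding T by (simp add: algebra_simps flip: scaleR_2)
  finally have T': "(x - DR A B x) - (y - DR A B y) = (1/2) *\<^sub>R ((x - y) - s)" .
  have "(norm ((1/2) *\<^sub>R ((x - y) + s)))\<^sup>2 + (norm ((1/2) *\<^sub>R ((x - y) - s)))\<^sup>2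
      = ((norm (x - y))\<^sup>2 + (norm s)\<^sup>2) / 2"
    unfolding power2_norm_eq_inner
    by (simp add: inner_add_left inner_add_right inner_diff_left inner_diff_right field_simps)
  also have "\<dots> \<le> (norm (x - y))\<^sup>2" using s by simp
  finally show "(norm (DR A B x - DR A B y))\<^sup>2 + (norm ((x - DR A B x) - (y - DR A B y)))\<^sup>2
      \<le> (norm (x - y))\<^sup>2"
    unfolding T T' .
qed

lemma DR_fixed_of_mem:
  fixes A B :: "'a::{real_inner,complete_space} set"
  assumes "closed A" "convex A" "closed B" "convex B" "p \<in> A" "p \<in> B"
  shows "DR A B p = p"
proof -
  have "proj A p = p" "proj B p = p" using assms by (auto intro: proj_eqI)
  then have "reflection A p = p" "reflection B p = p" by (simp_all add: reflection_def scaleR_2)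
  then show ?thesis by (simp add: DR_def flip: scaleR_2)
qed

lemma DR_fixed_imp_proj_mem:
  fixes A B :: "'a::{real_inner,complete_space} set"
  assumes B: "closed B" "convex B" "B \<noteq> {}" and fixed: "DR A B x = x"
  shows "proj A x \<in> B"
proof -
  define q where "q = proj B (reflection A x)"
  \<comment> \<open>In this form a fixed point is visibly one where \<open>proj A x\<close> equals
    \<open>q\<close>, a point of \<open>B\<close>.\<close>
  have "DR A B x = x + q - proj A x"
    by (simp add: DR_def reflection_def q_def algebra_simps flip: scaleR_2)
  then have "proj A x = q" using fixed by (metis add_diff_cancel_left' add_diff_eq eq_iff_diff_eq_0)
  then show ?thesis using proj_in[OF B] by (simp add: q_def)
qed

text \<open>Absorbs the closing factor \<open>DR (C N) (C 1)\<close> as the last list entry, by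
  letting the successor of \<open>N\<close> wrap around to 1. The results on lists of maps then
  apply.\<close>

lemma cyclic_DR_conv_fold:
  assumes "N \<ge> 1"
  shows "cyclic_DR N C
    = fold (\<lambda>T. T) (map (\<lambda>i. DR (C i) (C (if i = N then 1 else Suc i))) [1..<Suc N])"
proof -
  have "fold (\<lambda>i. DR (C i) (C (if i = N then 1 else Suc i))) [1..<N]
      = fold (\<lambda>i. DR (C i) (C (Suc i))) [1..<N]"
    by (intro ext List.fold_cong) auto
  then show ?thesis using assms by (simp add: cyclic_DR_def fold_map comp_def)
qed

text \<open>Each projection is a competitor in the next set, so the distances from \<open>x\<close>
  decrease around the cycle and hence agree. Uniqueness of nearest points then identifies
  consecutive projections.\<close>

lemma proj_eq_of_cyclic_mem:
  fixes C :: "nat \<Rightarrow> 'a::{real_inner,complete_space} set"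
  assumes N: "N \<ge> 1"
    and C: "\<And>i. i \<in> {1..N} \<Longrightarrow> closed (C i)" "\<And>i. i \<in> {1..N} \<Longrightarrow> convex (C i)"
    and mem: "\<And>i. i \<in> {1..N} \<Longrightarrow> proj (C i) x \<in> C (if i = N then 1 else Suc i)"
    and i: "i \<in> {1..N}"
  shows "proj (C i) x = proj (C 1) x"
proof -
  let ?d = "\<lambda>i. dist x (proj (C i) x)"
  have le: "?d (Suc i) \<le> ?d i" if "1 \<le> i" "i < N" for i
    using mem[of i] that C[of "Suc i"] by (intro proj_le) auto
  have last: "?d 1 \<le> ?d N"
    using mem[of N] N C[of 1] by (intro proj_le) auto
  have mono: "?d j \<le> ?d i" if "i \<le> j" "1 \<le> i" "j \<le> N" for i j
    using that by (induction j rule: dec_induct) (auto intro: order_trans[OF le])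
  \<comment> \<open>The chain \<open>?d N \<le> ?d i \<le> ?d 1 \<le> ?d N\<close> closes
    up.\<close>
  have eq: "?d i = ?d 1" if "i \<in> {1..N}" for i
    using mono[of 1 i] mono[of i N] last that by auto
  have step: "proj (C (Suc i)) x = proj (C i) x" if "1 \<le> i" "i < N" for i
  proof (rule proj_eqI)
    show "proj (C i) x \<in> C (Suc i)" using mem[of i] that by auto
    then show "dist x (proj (C i) x) \<le> dist x y" if "y \<in> C (Suc i)" for y
      using proj_le[of "C (Suc i)" y x] that C[of "Suc i"] eq[of i] eq[of "Suc i"]
        \<open>1 \<le> i\<close> \<open>i < N\<close> by auto
  qed (use C[of "Suc i"] that in auto)
  have "1 \<le> i" "i \<le> N" using i by auto
  then show ?thesis by (induction i rule: dec_induct) (auto simp: step)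
qed

theorem theorem3p1:
  fixes C :: "nat \<Rightarrow> 'a::{real_inner, complete_space} set"
    and N :: nat
    and x0 :: 'a
  assumes "N \<ge> 1"
    and "\<And>i. i \<in> {1..N} \<Longrightarrow> closed (C i)"
    and "\<And>i. i \<in> {1..N} \<Longrightarrow> convex (C i)"
    and "(\<Inter>i\<in>{1..N}. C i) \<noteq> {}"
  shows "\<exists>x. weakly_converges_to (\<lambda>n. (cyclic_DR N C ^^ n) x0) x
           \<and> (\<forall>i\<in>{1..N}. \<forall>j\<in>{1..N}. proj (C i) x = proj (C j) x)
           \<and> (\<forall>j\<in>{1..N}. proj (C j) x \<in> (\<Inter>i\<in>{1..N}. C i))"
proof -
  define next_idx where "next_idx i = (if i = N then 1 else Suc i)" for i
  define D where "D i = DR (C i) (C (next_idx i))" for i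
  have nxt: "next_idx i \<in> {1..N}" if "i \<in> {1..N}" for i
    using that by (auto simp: next_idx_def)
  obtain p where p: "\<And>i. i \<in> {1..N} \<Longrightarrow> p \<in> C i" using assms(4) by blast
  then have ne: "C i \<noteq> {}" if "i \<in> {1..N}" for i using that by blast
  have range: "set [1..<Suc N] = {1..N}" by auto
  have "\<exists>x. weakly_converges_to (\<lambda>n. (fold (\<lambda>T. T) (map D [1..<Suc N]) ^^ n) x0) x
      \<and> (\<forall>T\<in>set (map D [1..<Suc N]). T x = x)"
  proof (rule weak_convergence_iterated_fold)
    fix T assume "T \<in> set (map D [1..<Suc N])"
    then obtain i where i: "i \<in> {1..N}" "T = D i" unfolding set_map range by blast
    show "firmly_nonexpansive T"
      unfolding i D_def using i nxt[of i] assms(2,3) ne by (intro DR_firmly_nonexpansive) auto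
    show "T p = p"
      unfolding i D_def using i nxt[of i] assms(2,3) p by (intro DR_fixed_of_mem) auto
  qed
  moreover have "cyclic_DR N C = fold (\<lambda>T. T) (map D [1..<Suc N])"
    unfolding cyclic_DR_conv_fold[OF assms(1)] D_def next_idx_def ..
  ultimately obtain x where x: "weakly_converges_to (\<lambda>n. (cyclic_DR N C ^^ n) x0) x"
    and fix_x: "\<And>i. i \<in> {1..N} \<Longrightarrow> D i x = x"
    unfolding set_map range by auto
  \<comment> \<open>This needs \<open>x\<close> to be fixed by each factor separately, not only by
    their composition.\<close>
  have "proj (C i) x \<in> C (next_idx i)" if "i \<in> {1..N}" for i
    using fix_x[OF that] nxt[OF that] assms(2,3) ne
    unfolding D_def by (intro DR_fixed_imp_proj_mem) auto
  then have eq: "proj (C i) x = proj (C 1) x" if "i \<in> {1..N}" for i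
    using proj_eq_of_cyclic_mem[of N C x i] assms(1-3) that unfolding next_idx_def by blast
  \<comment> \<open>The \<open>j\<close>-th projection equals the \<open>i\<close>-th, which lies in
    \<open>C i\<close>.\<close>
  have "proj (C j) x \<in> C i" if "i \<in> {1..N}" "j \<in> {1..N}" for i j
    using proj_in[of "C i" x] eq that assms(2,3) ne by metis
  moreover have "proj (C i) x = proj (C j) x" if "i \<in> {1..N}" "j \<in> {1..N}" for i j
    using eq[OF that(1)] eq[OF that(2)] by simp
  ultimately show ?thesis using x by blast
qed

end
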